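(* Let $n\ge 2$ be an integer and let $a$ be a real number with $2\sqrt{n-1}\le a$. Let $(|b_k|)_{k\ge 0}$ be the real sequence defined by $|b_0| = 1/a$ and, for $k\ge 1$, $$|b_k| = \frac{1+(n-1)|b_{k-1}|^2}{a-(n-1)|b_{k-1}|} - |b_{k-1}|.$$ Then this sequence converges and moreover $$\lim_{k\to\infty}|b_k| = b,\qquad\text{where}\quad b=\frac{a-\sqrt{a^2-3(n-1)}}{3(n-1)}.$$
   Context: The symbol $|b_k|$ denotes the $k$-th term of the sequence specified in the claim. *)

theory Defs
  imports Complex_Main
begin

end

theory Submission imports Defs begin

text \<open>
  Write \<open>m = n - 1\<close>, \<open>s = sqrt (a\<^sup>2 - 3m)\<close> and let \<open>f\<close> be the iteration map. Its fixed points are the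
  roots of \<open>3m x\<^sup>2 - 2a x + 1\<close>; the smaller one is \<open>b = (a - s) / (3m) = 1 / (a + s)\<close>, and
  \<open>f x - b = (x - b) (2m x - s) / (a - m x)\<close>. The map \<open>f\<close> preserves the interval \<open>[0, 1/a]\<close>, and
  the assumption \<open>a \<ge> 2 sqrt m\<close> is what gives \<open>2m x \<le> s\<close> there, so that the last factor lies in
  \<open>[-s/a, 0]\<close>. Hence \<open>f\<close> shrinks the distance to \<open>b\<close> by the factor \<open>s/a < 1\<close>.
\<close>

lemma iteration_step:
  fixes m a x s :: real
  defines "b \<equiv> (a - s) / (3 * m)"
  defines "y \<equiv> (1 + m * x\<^sup>2) / (a - m * x) - x"
  assumes m: "m > 0" and a: "a > 0" and a2: "4 * m \<le> a\<^sup>2"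
    and s: "s \<ge> 0" "s\<^sup>2 = a\<^sup>2 - 3 * m"
    and x: "0 \<le> x" "x \<le> 1 / a"
  shows "0 \<le> y" "y \<le> 1 / a" "\<bar>y - b\<bar> \<le> s / a * \<bar>x - b\<bar>"
proof -
  have ax: "a * x \<le> 1"
    using x a by (simp add: field_simps)
  \<comment> \<open>This keeps the denominator \<open>a - m * x\<close> positive on the whole
    interval.\<close>
  have mx: "4 * (m * x) \<le> a"
  proof -
    have "4 * m * x \<le> a\<^sup>2 * x"
      using a2 x by (intro mult_right_mono) auto
    also have "\<dots> = a * (a * x)"
      by (simp add: power2_eq_square)
    also have "\<dots> \<le> a"
      using ax a by (intro mult_left_le) auto
    finally show ?thesis by simp
  qed
  have d: "a - m * x > 0"
    using mx a by linarith
  have y: "y = (1 - a * x + 2 * m * x\<^sup>2) / (a - m * x)"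
    using d by (simp add: y_def field_simps power2_eq_square)
  show "0 \<le> y"
    unfolding y using ax m d by (intro divide_nonneg_pos add_nonneg_nonneg) auto
  \<comment> \<open>Equivalent to \<open>2 * m * a * x\<^sup>2 + m * x \<le> a\<^sup>2 * x\<close>:
    by \<open>a * x \<le> 1\<close> the left side is at most \<open>3 * m * x\<close>, and
    \<open>4 * m \<le> a\<^sup>2\<close> finishes.\<close>
  have "a * (1 - a * x + 2 * m * x\<^sup>2) \<le> a - m * x"
  proof -
    have "x * (2 * m * (a * x)) \<le> x * (2 * m)"
      using x m ax by (intro mult_left_mono mult_left_le) auto
    moreover have "x * (4 * m) \<le> x * a\<^sup>2"
      using x a2 by (intro mult_left_mono) auto
    moreover have "0 \<le> m * x"
      using m x by simp
    ultimately show ?thesis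
      by (simp add: algebra_simps power2_eq_square)
  qed
  then show "y \<le> 1 / a"
    unfolding y using d a by (simp add: field_simps)
  have mbs: "3 * m * b = a - s"
    using m by (simp add: b_def)
  have root: "3 * m * b\<^sup>2 - 2 * a * b + 1 = 0"
  proof -
    \<comment> \<open>Scaling by \<open>3 * m\<close> gives a polynomial in
      \<open>3 * m * b = a - s\<close>, free of division.\<close>
    have "3 * m * (3 * m * b\<^sup>2 - 2 * a * b + 1) = (3 * m * b)\<^sup>2 - 2 * a * (3 * m * b) + 3 * m"
      by (simp add: algebra_simps power2_eq_square)
    also have "\<dots> = 0"
      unfolding mbs using s(2) by (simp add: algebra_simps power2_eq_square)
    finally show ?thesis
      using m by simp
  qed
  \<comment> \<open>The two sides differ by exactly the quadratic in \<open>root\<close>.\<close>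
  have "1 - a * x + 2 * m * x\<^sup>2 - b * (a - m * x) = (x - b) * (2 * m * x - a + 3 * m * b)"
    using root by (simp add: algebra_simps power2_eq_square)
  then have "1 - a * x + 2 * m * x\<^sup>2 - b * (a - m * x) = (x - b) * (2 * m * x - s)"
    using mbs by simp
  then have yb: "y - b = (x - b) * ((2 * m * x - s) / (a - m * x))"
    unfolding y using d by (simp add: field_simps)
  have "2 * m * x \<le> s"
  proof (rule power2_le_imp_le)
    \<comment> \<open>Up to the factor 4, the chain is \<open>(2 * m * x)\<^sup>2 \<le> m * (a *
      x)\<^sup>2 \<le> m \<le> s\<^sup>2\<close>; it uses \<open>4 * m \<le> a\<^sup>2\<close> at
      both ends.\<close>
    have "(2 * m * x)\<^sup>2 * 4 \<le> m * x\<^sup>2 * m * 16"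
      by (simp add: power2_eq_square)
    also have "\<dots> \<le> m * x\<^sup>2 * a\<^sup>2 * 4"
      using mult_left_mono[OF a2, of "m * x\<^sup>2 * 4"] m by (simp add: ac_simps)
    also have "\<dots> = m * (a * x)\<^sup>2 * 4"
      by (simp add: power2_eq_square)
    also have "\<dots> \<le> m * 1 * 4"
      using ax a x m by (intro mult_right_mono mult_left_mono power_le_one) auto
    also have "\<dots> \<le> s\<^sup>2 * 4"
      using s(2) a2 by simp
    finally show "(2 * m * x)\<^sup>2 \<le> s\<^sup>2" by simp
  qed (use s in simp)
  \<comment> \<open>After cancelling \<open>s\<close>, this is
    \<open>s / a * (m * x) \<le> 2 * (m * x)\<close>, which follows from
    \<open>s \<le> a\<close>.\<close>
  moreover have "s - 2 * m * x \<le> s / a * (a - m * x)"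
  proof -
    have "s \<le> a"
      by (rule power2_le_imp_le) (use s(2) m a in auto)
    then have "s / a * (m * x) \<le> 1 * (m * x)"
      using m x a by (intro mult_right_mono) auto
    moreover have "0 \<le> m * x"
      using m x by simp
    moreover have "s / a * (a - m * x) = s - s / a * (m * x)"
      using a by (simp add: right_diff_distrib)
    ultimately show ?thesis
      by simp
  qed
  ultimately have "\<bar>(2 * m * x - s) / (a - m * x)\<bar> \<le> s / a"
    using d by (simp add: abs_divide pos_divide_le_eq)
  then show "\<bar>y - b\<bar> \<le> s / a * \<bar>x - b\<bar>"
    unfolding yb abs_mult by (subst mult.commute) (intro mult_right_mono, auto)
qed

theorem theorem4:
  fixes n :: nat and a :: real and B :: "nat \<Rightarrow> real"
  assumes "n \<ge> 2"
    and "2 * sqrt (real n - 1) \<le> a"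
    and "B 0 = 1 / a"
    and "\<And>k. k \<ge> 1 \<Longrightarrow>
          B k = (1 + (real n - 1) * (B (k - 1))^2) / (a - (real n - 1) * B (k - 1)) - B (k - 1)"
  shows "B \<longlonglongrightarrow> (a - sqrt (a^2 - 3 * (real n - 1))) / (3 * (real n - 1))"
proof -
  define m where "m = real n - 1"
  define s where "s = sqrt (a\<^sup>2 - 3 * m)"
  define b where "b = (a - s) / (3 * m)"
  have m: "m > 0"
    using assms(1) by (simp add: m_def)
  have am: "2 * sqrt m \<le> a"
    using assms(2) by (simp add: m_def)
  moreover have "sqrt m > 0"
    using m by simp
  ultimately have a: "a > 0"
    by linarith
  have a2: "4 * m \<le> a\<^sup>2"
    using power_mono[OF am, of 2] m by (simp add: power_mult_distrib)
  have s: "s \<ge> 0" "s\<^sup>2 = a\<^sup>2 - 3 * m"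
    using a2 m by (simp_all add: s_def)
  have "s < a"
    by (rule power2_less_imp_less) (use s(2) m a in auto)
  note step = iteration_step[OF m a a2 s, folded b_def]
  have rec: "B (Suc k) = (1 + m * (B k)\<^sup>2) / (a - m * B k) - B k" for k
    using assms(4)[of "Suc k"] by (simp add: m_def)
  \<comment> \<open>The sequence starts at the right endpoint of the invariant interval, so the
    contraction estimate applies at every index.\<close>
  have range: "0 \<le> B k \<and> B k \<le> 1 / a" for k
  proof (induction k)
    case 0
    show ?case using assms(3) a by simp
  next
    case (Suc k)
    then show ?case
      unfolding rec using step(1,2)[of "B k"] by blast
  qed
  have bound: "\<bar>B k - b\<bar> \<le> (s / a) ^ k * \<bar>B 0 - b\<bar>" for k
  proof (induction k)
    case (Suc k)
    have "\<bar>B (Suc k) - b\<bar> \<le> s / a * \<bar>B k - b\<bar>"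
      unfolding rec using range[of k] by (intro step(3)) auto
    also have "\<dots> \<le> s / a * ((s / a) ^ k * \<bar>B 0 - b\<bar>)"
      using Suc s a by (intro mult_left_mono) auto
    finally show ?case by (simp add: mult.assoc)
  qed simp
  have "(\<lambda>k. (s / a) ^ k) \<longlonglongrightarrow> 0"
    using \<open>s < a\<close> s a by (intro LIMSEQ_realpow_zero) auto
  then have "(\<lambda>k. B k - b) \<longlonglongrightarrow> 0"
    by (rule tendsto_0_le[where K = "\<bar>B 0 - b\<bar>"]) (use bound s a in simp)
  then show ?thesis
    by (simp add: LIM_zero_iff b_def s_def m_def)
qed

end
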